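(* Let $\mathcal{H}$ be a real Hilbert space, let $F=\sum_{i=1}^N F_i$ where each $F_i:\mathcal{H}\to\mathcal{H}$ satisfies $\|F_i(x)-F_i(y)\|\le L_i\|x-y\|^{\alpha_i}$ for all $x,y\in\mathcal{H}$, with $\alpha_i\in\left(\frac13,1\right]$ and $L_i>0$ ($i=1,\dots,N$). Let $G:\mathcal{H}\to 2^{\mathcal{H}}$ be maximally monotone, let $T:=F+G$ be monotone, and assume $\mathrm{SOL}:=\{x\in\mathcal{H}\mid 0\in T(x)\}\neq\emptyset$. Put $\alpha=\min_{1\le i\le N}\alpha_i$ and let $0<s\le\min_{1\le i\le N}\frac{1}{(N^2L_i^2\alpha_i)^{\frac{1}{2\alpha_i}}}$. Let $\{x_k\}$ be generated by the GCFEG algorithm (given in the context) from a starting point $x_0\in\mathcal{H}$. Then $$\mathrm{dist}\bigl(0,T(x_K)\bigr)^2\le O\left(\left(\frac{1}{(3\alpha-1)^2s^2}+\sum_{i=1}^N\frac{(1-\alpha_i)\ln(K)}{N\alpha_i}\right)K^{-(3\alpha-1)}\right).$$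
   Context: A set-valued operator $T:\mathcal{H}\to 2^{\mathcal{H}}$ is monotone if $\langle u-v,x-y\rangle\ge 0$ for all $x,y\in\mathcal{H}$, $u\in T(x)$, $v\in T(y)$; it is maximally monotone if moreover its graph $\{(x,u)\mid u\in T(x)\}$ is not a proper subset of the graph of another monotone operator. $T(x)=F(x)+G(x)=\{F(x)+g\mid g\in G(x)\}$. For $s>0$ and $G$ maximally monotone, $J_{sG}:=(I+sG)^{-1}$, which is a single-valued map defined on all of $\mathcal{H}$. For $x\in\mathcal{H}$ and $\mathcal{S}\subset\mathcal{H}$, $\mathrm{dist}(x,\mathcal{S})=\inf_{y\in\mathcal{S}}\|x-y\|$. The notation $O(\cdot)$ is as $K\to\infty$, with the problem data, the parameters and the starting point fixed (the implied constant does not depend on $K$). GCFEG algorithm (Generalized Composite Fast Extra-gradient Method). Initialization: $x_0\in\mathcal{H}$, $\tilde g_0=0$, $\Sigma_0=0$, and $s$ as in the claim. For $k=0,1,2,\dots$ set successively $$s_{k+1}=\frac{s}{(k+1)^{\frac{3(1-\alpha)}{2}}},\qquad \beta_{k+1}=\frac{s_{k+1}}{2\Sigma_k+s_{k+1}},\qquad \tilde x_{k+1}=\beta_{k+1}x_0+(1-\beta_{k+1})x_k,$$ $$x_{k+\frac12}=\tilde x_{k+1}-(1-\beta_{k+1})s_{k+1}\bigl(F(x_k)+\tilde g_k\bigr),\qquad x_{k+1}=J_{s_{k+1}G}\bigl(\tilde x_{k+1}-s_{k+1}F(x_{k+\frac12})\bigr),$$ $$\tilde g_{k+1}=s_{k+1}^{-1}\bigl(\tilde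 x_{k+1}-x_{k+1}-s_{k+1}F(x_{k+\frac12})\bigr),\qquad \Sigma_{k+1}=\Sigma_k+\frac{s_{k+1}}{2}.$$ *)

theory Defs
  imports "HOL-Analysis.Analysis" "HOL-Library.Landau_Symbols"
begin

definition op_graph :: "('a \<Rightarrow> 'a set) \<Rightarrow> ('a \<times> 'a) set" where
  "op_graph T = {(x, u). u \<in> T x}"

definition monotone_operator :: "('a::real_inner \<Rightarrow> 'a set) \<Rightarrow> bool" where
  "monotone_operator T \<longleftrightarrow> (\<forall>x y. \<forall>u\<in>T x. \<forall>v\<in>T y. inner (u - v) (x - y) \<ge> 0)"

definition maximally_monotone :: "('a::real_inner \<Rightarrow> 'a set) \<Rightarrow> bool" where
  "maximally_monotone T \<longleftrightarrow>
     monotone_operator T \<and> \<not> (\<exists>S. monotone_operator S \<and> op_graph T \<subset> op_graph S)"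

definition op_sum :: "('a::plus \<Rightarrow> 'a) \<Rightarrow> ('a \<Rightarrow> 'a set) \<Rightarrow> 'a \<Rightarrow> 'a set" where
  "op_sum F G x = {F x + g | g. g \<in> G x}"

definition op_zeros :: "('a::zero \<Rightarrow> 'a set) \<Rightarrow> 'a set" where
  "op_zeros T = {x. 0 \<in> T x}"

(* (I + sG)^{-1} as a function.  The description is only meaningful where y has exactly one
   preimage under I + sG; for G maximally monotone on a Hilbert space and s > 0 this is every y
   (Minty). *)
definition resolvent :: "real \<Rightarrow> ('a::real_vector \<Rightarrow> 'a set) \<Rightarrow> 'a \<Rightarrow> 'a" where
  "resolvent s G y = (THE x. y \<in> {x + s *\<^sub>R g | g. g \<in> G x})"

(* The sequence x is generated by GCFEG from x0.  The remaining sequences are the auxiliary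
   quantities of the method, xh k being the iterate with index k + 1/2; st, b and xt are used
   only from index 1 on.  The equations determine x uniquely. *)
definition gcfeg ::
  "('a::real_inner \<Rightarrow> 'a) \<Rightarrow> ('a \<Rightarrow> 'a set) \<Rightarrow> real \<Rightarrow> real \<Rightarrow> 'a \<Rightarrow> (nat \<Rightarrow> 'a) \<Rightarrow> bool" where
  "gcfeg F G \<alpha> s x0 x \<longleftrightarrow>
     (\<exists>(st :: nat \<Rightarrow> real) (Sig :: nat \<Rightarrow> real) (b :: nat \<Rightarrow> real)
        (xt :: nat \<Rightarrow> 'a) (xh :: nat \<Rightarrow> 'a) (gt :: nat \<Rightarrow> 'a).
        x 0 = x0 \<and> gt 0 = 0 \<and> Sig 0 = 0 \<and>
        (\<forall>k.
           st (k + 1) = s / real (k + 1) powr (3 * (1 - \<alpha>) / 2) \<and>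
           b (k + 1) = st (k + 1) / (2 * Sig k + st (k + 1)) \<and>
           xt (k + 1) = b (k + 1) *\<^sub>R x0 + (1 - b (k + 1)) *\<^sub>R x k \<and>
           xh k = xt (k + 1) - ((1 - b (k + 1)) * st (k + 1)) *\<^sub>R (F (x k) + gt k) \<and>
           x (k + 1) = resolvent (st (k + 1)) G (xt (k + 1) - st (k + 1) *\<^sub>R F (xh k)) \<and>
           gt (k + 1) = (1 / st (k + 1)) *\<^sub>R (xt (k + 1) - x (k + 1) - st (k + 1) *\<^sub>R F (xh k)) \<and>
           Sig (k + 1) = Sig k + st (k + 1) / 2))"

end

theory Submission
  imports Defs
begin

text \<open>
  Write \<open>u\<^sub>k = F x\<^sub>k + g\<^sub>k\<close> for the residual that the method computes, where \<open>g\<^sub>k\<close> is the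
  vector \<open>gt k\<close>. As \<open>g\<^sub>k\<close> is recovered from a resolvent, it lies in \<open>G x\<^sub>k\<close>, so \<open>u\<^sub>k \<in> T x\<^sub>k\<close> for
  \<open>k \<ge> 1\<close> and it suffices to bound \<open>\<parallel>u\<^sub>K\<parallel>\<close>. That the resolvent is defined everywhere is Minty's
  theorem; it comes from minimising the sum of the Fitzpatrick function of \<open>G\<close> and half the squared
  norm (\<open>maximally_monotone_shifted_zero\<close>).

  The rate comes from the potential
  \<open>V\<^sub>k = \<Sigma>\<^sub>k\<^sup>2 \<parallel>u\<^sub>k\<parallel>\<^sup>2 + \<Sigma>\<^sub>k \<langle>u\<^sub>k, x\<^sub>k - x\<^sub>0\<rangle>\<close>. Put \<open>v\<^sub>k = F x\<^sub>k\<^sub>+\<^sub>\<half> + g\<^sub>k\<^sub>+\<^sub>1\<close>. Monotonicity of \<open>T\<close> between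
  consecutive iterates gives (\<open>anchored_lyapunov_step\<close>)

  \<open>V\<^sub>k\<^sub>+\<^sub>1 - V\<^sub>k \<le> \<Sigma>\<^sub>k\<^sub>+\<^sub>1\<^sup>2 (\<parallel>F x\<^sub>k\<^sub>+\<^sub>1 - F x\<^sub>k\<^sub>+\<^sub>\<half>\<parallel>\<^sup>2 - d\<^sup>2)\<close>, with
  \<open>d = \<parallel>v\<^sub>k - (1 - \<beta>\<^sub>k\<^sub>+\<^sub>1) u\<^sub>k\<parallel>\<close> and \<open>\<parallel>x\<^sub>k\<^sub>+\<^sub>1 - x\<^sub>k\<^sub>+\<^sub>\<half>\<parallel> = s\<^sub>k\<^sub>+\<^sub>1 d\<close>.

  For Lipschitz \<open>F\<close> the bracket is nonpositive once the step is small. For Hoelder summands Young's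
  inequality leaves an excess of at most \<open>S (k+1) powr (-3\<alpha>)\<close> with
  \<open>S = (\<Sum>i. (1 - a\<^sub>i) / (N a\<^sub>i))\<close> (\<open>hoelder_sum_increment_le\<close>). The decay of the steps makes
  \<open>\<Sigma>\<^sub>k\<^sup>2\<close> grow like \<open>k powr (3\<alpha> - 1)\<close> up to constant factors, so the increments of \<open>V\<close> are at most
  of order \<open>S / (k+1)\<close> and \<open>V\<^sub>K\<close> is at most of order \<open>S (1 + ln K)\<close>. Finally, at a zero \<open>z\<close> of \<open>T\<close> one has
  \<open>\<langle>u\<^sub>K, x\<^sub>K - z\<rangle> \<ge> 0\<close>, hence \<open>\<Sigma>\<^sub>K\<^sup>2 \<parallel>u\<^sub>K\<parallel>\<^sup>2 \<le> \<parallel>z - x\<^sub>0\<parallel>\<^sup>2 + 2 V\<^sub>K\<close>, and dividing by \<open>\<Sigma>\<^sub>K\<^sup>2\<close> gives an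
  explicit bound (\<open>gcfeg_residual_bound\<close>).
\<close>

section \<open>Resolvents of maximally monotone operators\<close>

text \<open>
  A point \<open>(z, t)\<close> of \<open>C\<close> stands for a point above the graph of an extended-real convex function, so
  that no infinite values are needed. By the parallelogram law a minimising sequence of
  \<open>t + \<parallel>z\<parallel>\<^sup>2 / 2\<close> is Cauchy in \<open>z\<close>, which replaces compactness. The second property of the minimiser
  says that \<open>- z0\<close> is a subgradient at \<open>z0\<close>.
\<close>
lemma strongly_convex_minimiser_on_closed_convex:
  fixes C :: "('a::{real_inner, complete_space} \<times> real) set"
  assumes "closed C" "convex C" "C \<noteq> {}"
    and bound: "\<And>z t. (z, t) \<in> C \<Longrightarrow> B \<le> t + (norm z)\<^sup>2 / 2"
  obtains z0 t0 where "(z0, t0) \<in> C"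
    and "\<And>z t. (z, t) \<in> C \<Longrightarrow> 0 \<le> t - t0 + inner z0 (z - z0)"
proof -
  define J :: "'a \<times> real \<Rightarrow> real" where "J = (\<lambda>(z, t). t + (norm z)\<^sup>2 / 2)"
  define m where "m = Inf (J ` C)"
  have bdd: "bdd_below (J ` C)"
    using bound by (intro bdd_belowI[of _ B]) (auto simp: J_def)
  have m_le: "m \<le> J p" if "p \<in> C" for p
    unfolding m_def using bdd that by (intro cInf_lower) auto
  have "\<exists>p. p \<in> C \<and> J p < m + inverse (real (Suc n))" for n
  proof -
    have "Inf (J ` C) < m + inverse (real (Suc n))" unfolding m_def by simp
    then show ?thesis using cInf_lessD[of "J ` C"] assms(3) by blast
  qed
  then obtain p where p: "\<And>n. p n \<in> C" "\<And>n. J (p n) < m + inverse (real (Suc n))"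
    by metis
  define z t where "z = (\<lambda>n. fst (p n))" and "t = (\<lambda>n. snd (p n))"
  have p_eq: "p n = (z n, t n)" for n by (simp add: z_def t_def)
  have close: "(dist (z i) (z j))\<^sup>2 \<le> 4 * (inverse (real (Suc i)) + inverse (real (Suc j)))" for i j
  proof -
    have "(1/2) *\<^sub>R p i + (1/2) *\<^sub>R p j \<in> C"
      using assms(2) p(1) by (intro convexD) auto
    from m_le[OF this]
    have "m \<le> (t i + t j) / 2 + (norm ((1/2) *\<^sub>R z i + (1/2) *\<^sub>R z j))\<^sup>2 / 2"
      by (simp add: J_def p_eq field_simps)
    moreover have "(norm ((1/2) *\<^sub>R z i + (1/2) *\<^sub>R z j))\<^sup>2
        = ((norm (z i))\<^sup>2 + (norm (z j))\<^sup>2) / 2 - (dist (z i) (z j))\<^sup>2 / 4"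
      by (simp add: dist_norm power2_norm_eq_inner inner_simps inner_commute field_simps)
    moreover have "J (p i) < m + inverse (real (Suc i))" "J (p j) < m + inverse (real (Suc j))"
      by (rule p)+
    ultimately show ?thesis unfolding J_def p_eq prod.case by argo
  qed
  have "Cauchy z"
  proof (rule metric_CauchyI)
    fix e :: real assume "e > 0"
    then obtain M where M: "inverse (real (Suc M)) < e\<^sup>2 / 8"
      using reals_Archimedean[of "e\<^sup>2 / 8"] by auto
    show "\<exists>M. \<forall>i\<ge>M. \<forall>j\<ge>M. dist (z i) (z j) < e"
    proof (intro exI allI impI)
      fix i j assume "M \<le> i" "M \<le> j"
      then have "inverse (real (Suc i)) \<le> inverse (real (Suc M))"
        "inverse (real (Suc j)) \<le> inverse (real (Suc M))"
        by (auto intro!: le_imp_inverse_le)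
      then have "(dist (z i) (z j))\<^sup>2 < e\<^sup>2"
        using close[of i j] M by argo
      then show "dist (z i) (z j) < e"
        using \<open>e > 0\<close> by (meson less_imp_le power2_less_imp_less)
    qed
  qed
  then obtain z0 where z0: "z \<longlonglongrightarrow> z0"
    using Cauchy_convergent convergent_def by blast
  have J_lim: "(\<lambda>n. J (p n)) \<longlonglongrightarrow> m"
  proof (rule real_tendsto_sandwich)
    show "\<forall>\<^sub>F n in sequentially. m \<le> J (p n)" using m_le p by simp
    show "\<forall>\<^sub>F n in sequentially. J (p n) \<le> m + inverse (real (Suc n))"
      using p(2) by (simp add: less_imp_le)
    show "(\<lambda>n. m + inverse (real (Suc n))) \<longlonglongrightarrow> m"
      using tendsto_add[OF tendsto_const LIMSEQ_inverse_real_of_nat, of m] by simp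
  qed simp
  define t0 where "t0 = m - (norm z0)\<^sup>2 / 2"
  have "(\<lambda>n. J (p n) - (norm (z n))\<^sup>2 / 2) \<longlonglongrightarrow> t0"
    unfolding t0_def by (intro tendsto_intros J_lim z0) simp
  then have "t \<longlonglongrightarrow> t0" by (simp add: J_def p_eq)
  then have "p \<longlonglongrightarrow> (z0, t0)"
    using tendsto_Pair[OF z0] by (simp add: p_eq[abs_def])
  then have mem: "(z0, t0) \<in> C"
    using assms(1) p(1) closed_sequentially by blast
  show thesis
  proof (rule that[OF mem])
    fix y r assume yr: "(y, r) \<in> C"
    \<comment> \<open>First-order optimality: compare with the segment towards \<open>(y, r)\<close>, divide by its parameter
        and let that tend to zero.\<close>
    have pos: "0 \<le> r - t0 + inner z0 (y - z0) + l * ((norm (y - z0))\<^sup>2 / 2)"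
      if l: "0 < l" "l \<le> 1" for l
    proof -
      have "(1 - l) *\<^sub>R (z0, t0) + l *\<^sub>R (y, r) \<in> C"
        using assms(2) mem yr l by (intro convexD) auto
      from m_le[OF this]
      have "m \<le> (1 - l) * t0 + l * r + (norm ((1 - l) *\<^sub>R z0 + l *\<^sub>R y))\<^sup>2 / 2"
        by (simp add: J_def)
      also have "(1 - l) *\<^sub>R z0 + l *\<^sub>R y = z0 + l *\<^sub>R (y - z0)"
        by (simp add: algebra_simps)
      also have "(norm (z0 + l *\<^sub>R (y - z0)))\<^sup>2
          = (norm z0)\<^sup>2 + 2 * l * inner z0 (y - z0) + l\<^sup>2 * (norm (y - z0))\<^sup>2"
        unfolding power2_norm_eq_inner
        by (simp only: inner_add_left inner_add_right inner_scaleR_left inner_scaleR_right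
            inner_commute[of "y - z0" z0]) (simp add: algebra_simps power2_eq_square)
      finally have le: "m \<le> (1 - l) * t0 + l * r
          + ((norm z0)\<^sup>2 + 2 * l * inner z0 (y - z0) + l\<^sup>2 * (norm (y - z0))\<^sup>2) / 2" .
      have "0 \<le> l * (r - t0 + X + l * (D / 2))"
        if "m \<le> (1 - l) * t0 + l * r + (q + 2 * l * X + l\<^sup>2 * D) / 2" "m = t0 + q / 2" for X D q
        using that(1) unfolding that(2) by (simp add: field_simps power2_eq_square)
      from this[OF le]
      have "0 \<le> l * (r - t0 + inner z0 (y - z0) + l * ((norm (y - z0))\<^sup>2 / 2))"
        by (simp add: t0_def)
      then show ?thesis using l by (simp add: zero_le_mult_iff)
    qed
    show "0 \<le> r - t0 + inner z0 (y - z0)"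
    proof (rule tendsto_lowerbound)
      show "((\<lambda>l. r - t0 + inner z0 (y - z0) + l * ((norm (y - z0))\<^sup>2 / 2))
          \<longlongrightarrow> r - t0 + inner z0 (y - z0)) (at_right 0)"
        by (auto intro!: tendsto_eq_intros)
      show "\<forall>\<^sub>F l in at_right 0. 0 \<le> r - t0 + inner z0 (y - z0) + l * ((norm (y - z0))\<^sup>2 / 2)"
        using pos by (auto simp: eventually_at_right_field intro!: exI[of _ 1])
    qed simp
  qed
qed

text \<open>
  Maximality in usable form: a pair that is monotonically related to the whole graph could be added
  to it, hence already belongs to it.
\<close>
lemma maximally_monotone_iff:
  fixes G :: "'a::real_inner \<Rightarrow> 'a set"
  shows "maximally_monotone G \<longleftrightarrow> monotone_operator G \<and>
    (\<forall>x u. (\<forall>y. \<forall>v\<in>G y. inner (u - v) (x - y) \<ge> 0) \<longrightarrow> u \<in> G x)"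
proof (intro iffI conjI allI impI)
  assume max: "maximally_monotone G"
  then show mono: "monotone_operator G" by (simp add: maximally_monotone_def)
  fix x u assume rel: "\<forall>y. \<forall>v\<in>G y. inner (u - v) (x - y) \<ge> 0"
  define S where "S = G(x := insert u (G x))"
  have rel': "inner (v - u) (y - x) \<ge> 0" if "v \<in> G y" for y v
    using rel that by (metis inner_minus_left inner_minus_right minus_diff_eq)
  have "monotone_operator S"
    using mono rel rel' unfolding monotone_operator_def S_def by auto
  moreover have "op_graph G \<subseteq> op_graph S" by (auto simp: op_graph_def S_def)
  ultimately have "op_graph G = op_graph S"
    using max unfolding maximally_monotone_def by blast
  moreover have "(x, u) \<in> op_graph S" by (simp add: op_graph_def S_def)
  ultimately show "u \<in> G x" by (auto simp: op_graph_def)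
next
  assume asm: "monotone_operator G \<and>
    (\<forall>x u. (\<forall>y. \<forall>v\<in>G y. inner (u - v) (x - y) \<ge> 0) \<longrightarrow> u \<in> G x)"
  show "maximally_monotone G"
    unfolding maximally_monotone_def
  proof (intro conjI notI)
    show "monotone_operator G" using asm by simp
    assume "\<exists>S. monotone_operator S \<and> op_graph G \<subset> op_graph S"
    then obtain S where S: "monotone_operator S" "op_graph G \<subset> op_graph S" by blast
    then have sub: "v \<in> S y" if "v \<in> G y" for y v
      using that by (auto simp: op_graph_def)
    obtain x u where xu: "u \<in> S x" "u \<notin> G x" using S(2) by (auto simp: op_graph_def)
    then have "\<forall>y. \<forall>v\<in>G y. inner (u - v) (x - y) \<ge> 0"
      using S(1) sub unfolding monotone_operator_def by blast
    then show False using asm xu by blast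
  qed
qed

text \<open>
  The core of Minty's theorem: \<open>0\<close> is in the range of \<open>I + G\<close>. The set \<open>C\<close> below is the epigraph of
  the Fitzpatrick function \<open>\<phi>\<close> of \<open>G\<close>. Maximality gives \<open>\<phi> (x, u) \<ge> \<langle>x, u\<rangle>\<close>, monotonicity gives
  equality on the graph. Let \<open>(p, q)\<close> minimise \<open>\<phi> + \<parallel>\<cdot>\<parallel>\<^sup>2 / 2\<close>. Testing optimality at points of the
  graph shows that \<open>(- q, - p)\<close> is monotonically related to the graph, with the surplus
  \<open>\<parallel>p + q\<parallel>\<^sup>2\<close>. So \<open>(- q, - p)\<close> is in the graph, and testing at this very point forces \<open>p = - q\<close>.
\<close>
lemma maximally_monotone_shifted_zero:
  fixes G :: "'a::{real_inner, complete_space} \<Rightarrow> 'a set"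
  assumes "maximally_monotone G"
  shows "\<exists>x. - x \<in> G x"
proof -
  have mono: "inner (u - v) (x - y) \<ge> 0" if "u \<in> G x" "v \<in> G y" for x y u v
    using assms that unfolding maximally_monotone_def monotone_operator_def by blast
  have max: "u \<in> G x" if "\<And>y v. v \<in> G y \<Longrightarrow> inner (u - v) (x - y) \<ge> 0" for x u
    using assms that unfolding maximally_monotone_iff by blast
  define C :: "(('a \<times> 'a) \<times> real) set" where
    "C = {((x, u), t). \<forall>y. \<forall>v\<in>G y. inner x v + inner y u - inner y v \<le> t}"
  have C_eq: "C = (\<Inter>y. \<Inter>v\<in>G y. {p. inner (v, y) (fst p) - snd p \<le> inner y v})"
    by (auto simp: C_def inner_prod_def inner_commute algebra_simps)
  have closed: "closed C"
    unfolding C_eq by (intro closed_INT ballI closed_Collect_le continuous_intros)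
  have convex: "convex C"
    unfolding C_eq
  proof (intro convex_INT)
    fix y v
    have "{p. inner (v, y) (fst p) - snd p \<le> inner y v}
        = {p. inner ((v, y), -1::real) p \<le> inner y v}"
      by (simp add: inner_prod_def)
    then show "convex {p. inner (v, y) (fst p) - snd p \<le> inner y v}"
      by (simp add: convex_halfspace_le)
  qed
  have graph_C: "((y, v), inner y v) \<in> C" if "v \<in> G y" for y v
  proof -
    have "inner y v' + inner y' v - inner y' v' \<le> inner y v" if "v' \<in> G y'" for y' v'
      using mono[OF \<open>v \<in> G y\<close> that]
      by (simp add: inner_diff_left inner_diff_right inner_commute[of v] inner_commute[of v'])
    then show ?thesis by (simp add: C_def)
  qed
  have above: "inner x u \<le> t" if "((x, u), t) \<in> C" for x u t
  proof (rule ccontr)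
    assume "\<not> inner x u \<le> t"
    then have lt: "inner x v + inner y u - inner y v < inner x u" if "v \<in> G y" for y v
      using that \<open>((x, u), t) \<in> C\<close> by (fastforce simp: C_def)
    have "u \<in> G x"
      using lt by (intro max) (fastforce simp: inner_diff inner_commute algebra_simps)
    from lt[OF this] show False by simp
  qed
  have "\<exists>y v. v \<in> G y"
    using max by (metis equals0D)
  then have "C \<noteq> {}" using graph_C by blast
  have nonneg: "0 \<le> t + (norm z)\<^sup>2 / 2" if "(z, t) \<in> C" for z t
  proof (cases z)
    case (Pair x u)
    have "0 \<le> (norm (x + u))\<^sup>2" by simp
    also have "\<dots> = (norm z)\<^sup>2 + 2 * inner x u"
      by (simp add: Pair power2_norm_eq_inner inner_prod_def inner_simps inner_commute)
    finally show ?thesis using above[of x u t] that Pair by simp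
  qed
  obtain z0 t0 where z0: "(z0, t0) \<in> C"
    and opt: "\<And>z t. (z, t) \<in> C \<Longrightarrow> 0 \<le> t - t0 + inner z0 (z - z0)"
    using strongly_convex_minimiser_on_closed_convex[OF closed convex \<open>C \<noteq> {}\<close> nonneg] by blast
  obtain p q where z0_eq: "z0 = (p, q)" by (cases z0)
  have key: "(norm (p + q))\<^sup>2 \<le> inner (- p - v) (- q - y)" if "v \<in> G y" for y v
  proof -
    have "0 \<le> inner y v - t0 + inner p (y - p) + inner q (v - q)"
      using opt[OF graph_C[OF that]] by (simp add: z0_eq inner_prod_def)
    moreover have "inner p q \<le> t0" using above z0 z0_eq by simp
    ultimately show ?thesis
      by (simp add: power2_norm_eq_inner inner_simps inner_commute)
  qed
  have "- p \<in> G (- q)"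
    using key by (intro max) (meson order_trans zero_le_power2)
  moreover from key[OF this] have "p = - q"
    by (simp add: eq_neg_iff_add_eq_0)
  ultimately show ?thesis by (metis minus_minus)
qed

text \<open>
  Solving \<open>y \<in> x + s G x\<close> is finding a zero of \<open>I + (s G - y)\<close>, so the general resolvent equation
  reduces to the previous lemma.
\<close>
lemma maximally_monotone_affine:
  fixes G :: "'a::real_inner \<Rightarrow> 'a set"
  assumes "maximally_monotone G" "0 < s"
  shows "maximally_monotone (\<lambda>x. (\<lambda>g. s *\<^sub>R g - y) ` G x)"
  unfolding maximally_monotone_iff
proof (intro conjI allI impI)
  show "monotone_operator (\<lambda>x. (\<lambda>g. s *\<^sub>R g - y) ` G x)"
    using assms unfolding maximally_monotone_def monotone_operator_def
    by (auto simp flip: scaleR_diff_right)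
next
  fix x u
  assume rel: "\<forall>w. \<forall>v\<in>(\<lambda>g. s *\<^sub>R g - y) ` G w. inner (u - v) (x - w) \<ge> 0"
  have "inner ((1 / s) *\<^sub>R (u + y) - v) (x - w) \<ge> 0" if "v \<in> G w" for w v
  proof -
    have "u - (s *\<^sub>R v - y) = s *\<^sub>R ((1 / s) *\<^sub>R (u + y) - v)"
      using assms(2) by (simp add: algebra_simps)
    then show ?thesis
      using rel that assms(2) by (fastforce simp: zero_le_mult_iff)
  qed
  then have "(1 / s) *\<^sub>R (u + y) \<in> G x"
    using assms(1) unfolding maximally_monotone_iff by blast
  moreover have "u = s *\<^sub>R ((1 / s) *\<^sub>R (u + y)) - y"
    using assms(2) by simp
  ultimately show "u \<in> (\<lambda>g. s *\<^sub>R g - y) ` G x" by blast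
qed

text \<open>
  This is the form in which the method uses Minty's theorem. Uniqueness of the preimage, which gives
  the description operator its meaning, is monotonicity: two preimages \<open>x\<close>, \<open>x'\<close> of \<open>y\<close> have images
  under \<open>s G\<close> that differ by \<open>- (x' - x)\<close>.
\<close>
lemma resolvent_residual_mem:
  fixes G :: "'a::{real_inner, complete_space} \<Rightarrow> 'a set"
  assumes "maximally_monotone G" "0 < s"
  shows "(1 / s) *\<^sub>R (y - resolvent s G y) \<in> G (resolvent s G y)"
proof -
  obtain x where "- x \<in> (\<lambda>g. s *\<^sub>R g - y) ` G x"
    using maximally_monotone_shifted_zero[OF maximally_monotone_affine[OF assms]] by blast
  then obtain g where g: "g \<in> G x" "y = x + s *\<^sub>R g"
    by (auto simp: algebra_simps)
  have "x' = x" if "g' \<in> G x'" "y = x' + s *\<^sub>R g'" for x' g'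
  proof -
    have "0 \<le> s * inner (g' - g) (x' - x)"
      using assms g(1) that(1) unfolding maximally_monotone_def monotone_operator_def by simp
    also have "\<dots> = inner (s *\<^sub>R (g' - g)) (x' - x)" by simp
    also have "s *\<^sub>R (g' - g) = - (x' - x)"
      using g(2) that(2) by (simp add: algebra_simps)
    finally have "inner (x' - x) (x' - x) \<le> 0" by (simp only: inner_minus_left)
    then show ?thesis by (metis eq_iff_diff_eq_0 inner_ge_zero inner_eq_zero_iff order_antisym)
  qed
  then have "resolvent s G y = x"
    unfolding resolvent_def using g by (intro the_equality) auto
  then show ?thesis using g assms(2) by simp
qed


section \<open>Real estimates\<close>

text \<open>
  Young's inequality with \<open>t0\<close> as a free parameter: the Hoelder growth \<open>t powr a\<close> is absorbed by \<open>t\<close>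
  with coefficient exactly \<open>1\<close>, at the cost of an error that vanishes for \<open>a = 1\<close>. Leaving \<open>t0\<close> free
  treats \<open>a = 1\<close> together with \<open>a < 1\<close> and allows one \<open>t0\<close> for several exponents.
\<close>
lemma scaled_powr_le_affine:
  fixes a c t t0 :: real
  assumes "0 < a" "a \<le> 1" "0 \<le> t" "0 < t0" "c * a \<le> t0 powr (1 - a)"
  shows "c * t powr a \<le> t + (1 - a) / a * t0"
proof (cases "t = 0")
  case False
  have "c * a * t powr a \<le> t0 powr (1 - a) * t powr a"
    using assms by (intro mult_right_mono) auto
  also have "\<dots> \<le> a * t + (1 - a) * t0"
    using Youngs_inequality_0[of a "1 - a" t t0] assms False by (simp add: mult.commute)
  finally show ?thesis using assms(1) by (simp add: field_simps)
qed (use assms in simp)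

text \<open>
  Concavity of \<open>t powr (1 - p)\<close>, as weighted AM-GM for \<open>k\<close> and \<open>k + 1\<close>.
\<close>
lemma powr_increment_ge:
  fixes p :: real
  assumes "0 \<le> p" "p < 1"
  shows "real k powr (1 - p) + (1 - p) * real (Suc k) powr (- p) \<le> real (Suc k) powr (1 - p)"
proof (cases "k = 0")
  case False
  have "real k powr (1 - p) * real (Suc k) powr p \<le> (1 - p) * real k + p * real (Suc k)"
    using assms False by (intro Youngs_inequality_0) auto
  also have "\<dots> = real (Suc k) - (1 - p)" by (simp add: algebra_simps)
  finally have "real k powr (1 - p) * real (Suc k) powr p * real (Suc k) powr (- p)
      \<le> (real (Suc k) - (1 - p)) * real (Suc k) powr (- p)"
    by (intro mult_right_mono) auto
  moreover have "real (Suc k) powr p * real (Suc k) powr (- p) = 1"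
    by (simp flip: powr_add)
  moreover have "real (Suc k) * real (Suc k) powr (- p) = real (Suc k) powr (1 - p)"
    by (simp add: powr_mult_base)
  ultimately show ?thesis by (simp add: algebra_simps)
qed (use assms in simp)

text \<open>
  The lower bound replaces every term by the smallest one, the upper bound telescopes. Both have the
  order \<open>k powr (1 - p)\<close>, so \<open>\<Sigma>\<^sub>k\<close> is known up to constant factors.
\<close>
lemma sum_powr_bounds:
  fixes p :: real
  assumes "0 \<le> p" "p < 1"
  shows "real k powr (1 - p) \<le> (\<Sum>j<k. real (Suc j) powr (- p))"
    and "(1 - p) * (\<Sum>j<k. real (Suc j) powr (- p)) \<le> real k powr (1 - p)"
proof -
  have "real k * real k powr (- p) \<le> (\<Sum>j<k. real (Suc j) powr (- p))"
  proof -
    have "real k powr (- p) \<le> real (Suc j) powr (- p)" if "j < k" for j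
      using assms that by (intro powr_mono2') auto
    then have "(\<Sum>j<k. real k powr (- p)) \<le> (\<Sum>j<k. real (Suc j) powr (- p))"
      by (intro sum_mono) auto
    then show ?thesis by simp
  qed
  then show "real k powr (1 - p) \<le> (\<Sum>j<k. real (Suc j) powr (- p))"
    by (simp add: powr_mult_base)
  show "(1 - p) * (\<Sum>j<k. real (Suc j) powr (- p)) \<le> real k powr (1 - p)"
  proof (induction k)
    case (Suc k)
    then show ?case using powr_increment_ge[OF assms, of k] by (simp add: algebra_simps)
  qed simp
qed

lemma sum_inverse_le_ln:
  assumes "1 \<le> K"
  shows "(\<Sum>k<K. 1 / real (Suc k)) \<le> 1 + ln (real K)"
  using assms
proof (induction K rule: dec_induct)
  case (step K)
  have "ln (real K / real (Suc K)) \<le> real K / real (Suc K) - 1"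
    using step.hyps by (intro ln_le_minus_one) auto
  also have "\<dots> = - (1 / real (Suc K))" by (simp add: field_simps)
  finally have "1 / real (Suc K) \<le> ln (real (Suc K)) - ln (real K)"
    using step.hyps by (simp add: ln_div)
  then show ?case using step.IH by simp
qed simp

section \<open>One step of the anchored extragradient method\<close>

text \<open>
  Here \<open>u\<close> and \<open>w\<close> are the residuals at \<open>x\<close> and at the next iterate \<open>x'\<close>, and \<open>v\<close> is the direction
  actually used in the step. The anchoring weight \<open>b\<close> is chosen so that \<open>\<Sigma>' b = \<sigma> / 2\<close> and
  \<open>\<Sigma>' (1 - b) = \<Sigma>\<close>. With these weights the two sides of the conclusion differ by exactly
  \<open>(2 \<Sigma> \<Sigma>' / \<sigma>) \<langle>w - u, x' - x\<rangle>\<close>, so the inequality is monotonicity. For \<open>\<Sigma> = 0\<close> the factor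
  vanishes; this is the initial step, where \<open>u\<close> need not be a value of the operator.
\<close>
lemma anchored_lyapunov_step:
  fixes u w v x x' x0 :: "'a::real_inner" and \<Sigma> \<Sigma>' \<sigma> b :: real
  assumes "0 \<le> \<Sigma>" "0 < \<sigma>"
    and \<Sigma>': "\<Sigma>' = \<Sigma> + \<sigma> / 2"
    and b: "b = \<sigma> / (2 * \<Sigma> + \<sigma>)"
    and x': "x' = b *\<^sub>R x0 + (1 - b) *\<^sub>R x - \<sigma> *\<^sub>R v"
    and mono: "\<Sigma> > 0 \<Longrightarrow> inner (w - u) (x' - x) \<ge> 0"
  shows "\<Sigma>'\<^sup>2 * (norm w)\<^sup>2 + \<Sigma>' * inner w (x' - x0)
    \<le> \<Sigma>\<^sup>2 * (norm u)\<^sup>2 + \<Sigma> * inner u (x - x0)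
      + \<Sigma>'\<^sup>2 * ((norm (w - v))\<^sup>2 - (norm (v - (1 - b) *\<^sub>R u))\<^sup>2)"
proof -
  have pos: "\<Sigma>' > 0" using assms by simp
  have b\<Sigma>': "\<Sigma>' * b = \<sigma> / 2" "\<Sigma>' * (1 - b) = \<Sigma>"
  proof -
    have "b = \<sigma> / (2 * \<Sigma>')" by (simp add: b \<Sigma>')
    then show "\<Sigma>' * b = \<sigma> / 2" using pos by simp
    then show "\<Sigma>' * (1 - b) = \<Sigma>" by (simp add: right_diff_distrib \<Sigma>')
  qed
  have "\<Sigma>' *\<^sub>R (x' - x0) = (\<Sigma>' * (1 - b)) *\<^sub>R (x - x0) - (\<Sigma>' * \<sigma>) *\<^sub>R v"
    by (simp add: x' algebra_simps)
  then have anchor: "\<Sigma>' * inner w (x' - x0) = \<Sigma> * inner w (x - x0) - \<Sigma>' * \<sigma> * inner w v"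
    by (metis b\<Sigma>'(2) inner_diff_right inner_scaleR_right)
  have "\<Sigma>' *\<^sub>R (x' - x) = (\<Sigma>' * b) *\<^sub>R (x0 - x) - (\<Sigma>' * \<sigma>) *\<^sub>R v"
    by (simp add: x' algebra_simps)
  then have "\<Sigma>' * inner (w - u) (x' - x) = \<sigma> / 2 * inner (w - u) (x0 - x) - \<Sigma>' * \<sigma> * inner (w - u) v"
    by (metis b\<Sigma>'(1) inner_diff_right inner_scaleR_right)
  also have "\<dots> = \<sigma> / 2 * (- inner (w - u) (x - x0) - 2 * \<Sigma>' * inner (w - u) v)"
    by (simp add: algebra_simps inner_diff_right)
  finally have step: "\<Sigma>' * inner (w - u) (x' - x)
      = \<sigma> / 2 * (- inner (w - u) (x - x0) - 2 * \<Sigma>' * inner (w - u) v)" .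
  have "0 \<le> \<Sigma> * (- inner (w - u) (x - x0) - 2 * \<Sigma>' * inner (w - u) v)"
  proof (cases "\<Sigma> = 0")
    case False
    then have "0 \<le> \<Sigma>' * inner (w - u) (x' - x)" using mono assms(1) pos by simp
    then show ?thesis unfolding step using assms(1,2) by (simp add: zero_le_mult_iff)
  qed simp
  then have key: "0 \<le> - (\<Sigma> * inner w (x - x0)) + \<Sigma> * inner u (x - x0)
      - 2 * \<Sigma> * \<Sigma>' * inner w v + 2 * \<Sigma> * \<Sigma>' * inner u v"
    by (simp add: inner_diff_left algebra_simps)
  have "\<Sigma>' *\<^sub>R (v - (1 - b) *\<^sub>R u) = \<Sigma>' *\<^sub>R v - \<Sigma> *\<^sub>R u"
    by (simp add: scaleR_diff_right b\<Sigma>')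
  then have "\<Sigma>' * norm (v - (1 - b) *\<^sub>R u) = norm (\<Sigma>' *\<^sub>R v - \<Sigma> *\<^sub>R u)"
    using pos by (metis abs_of_pos norm_scaleR)
  then have "\<Sigma>'\<^sup>2 * (norm (v - (1 - b) *\<^sub>R u))\<^sup>2 = (norm (\<Sigma>' *\<^sub>R v - \<Sigma> *\<^sub>R u))\<^sup>2"
    by (metis power_mult_distrib)
  also have "\<dots> = \<Sigma>'\<^sup>2 * inner v v - 2 * \<Sigma> * \<Sigma>' * inner u v + \<Sigma>\<^sup>2 * inner u u"
    unfolding power2_norm_eq_inner inner_diff_left inner_diff_right inner_scaleR_left
      inner_scaleR_right inner_commute[of v u]
    by (simp add: algebra_simps power2_eq_square)
  finally have n1: "\<Sigma>'\<^sup>2 * (norm (v - (1 - b) *\<^sub>R u))\<^sup>2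
      = \<Sigma>'\<^sup>2 * inner v v - 2 * \<Sigma> * \<Sigma>' * inner u v + \<Sigma>\<^sup>2 * inner u u" .
  have n2: "\<Sigma>'\<^sup>2 * (norm (w - v))\<^sup>2
      = \<Sigma>'\<^sup>2 * inner w w - 2 * \<Sigma>'\<^sup>2 * inner w v + \<Sigma>'\<^sup>2 * inner v v"
    by (simp add: power2_norm_eq_inner inner_diff_left inner_diff_right inner_commute[of v w]
        algebra_simps)
  have "2 * \<Sigma>'\<^sup>2 * inner w v = 2 * \<Sigma> * \<Sigma>' * inner w v + \<Sigma>' * \<sigma> * inner w v"
    unfolding \<Sigma>' by (simp add: algebra_simps power2_eq_square)
  then show ?thesis
    unfolding right_diff_distrib n1 n2 anchor unfolding power2_norm_eq_inner using key by linarith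
qed

lemma stepsize_le_imp_powr_le_1:
  fixes c s a :: real
  assumes "0 < c" "0 < s" "0 < a" "s \<le> 1 / c powr (1 / (2 * a))"
  shows "c * s powr (2 * a) \<le> 1"
proof -
  have "s powr (2 * a) \<le> (1 / c powr (1 / (2 * a))) powr (2 * a)"
    using assms by (intro powr_mono2) auto
  also have "\<dots> = 1 / c" using assms by (simp add: powr_divide powr_powr)
  finally show ?thesis using assms(1) by (simp add: field_simps)
qed

text \<open>
  The squared sum costs a factor \<open>N\<close>, and each of the \<open>N\<close> summands may use the share \<open>d\<^sup>2 / N\<close>. This is
  the source of \<open>N\<^sup>2\<close> in the step size condition. Young's inequality is applied to all summands with the same
  parameter \<open>t0 = n powr (-3\<alpha>)\<close>. It is admissible because \<open>(1 - \<alpha>) a\<^sub>i \<ge> \<alpha> (1 - a\<^sub>i)\<close>, which is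
  \<open>a\<^sub>i \<ge> \<alpha>\<close>; equality at the smallest exponent explains the decay rate of the step size.
\<close>
lemma hoelder_sum_increment_le:
  fixes Fi :: "nat \<Rightarrow> 'a::real_normed_vector \<Rightarrow> 'a" and L a :: "nat \<Rightarrow> real"
    and N :: nat and \<alpha> s n d :: real
  assumes N: "N \<ge> 1"
    and a: "\<And>i. i \<in> {1..N} \<Longrightarrow> 0 < a i \<and> \<alpha> \<le> a i \<and> a i \<le> 1"
    and L: "\<And>i. i \<in> {1..N} \<Longrightarrow> L i > 0"
    and hoelder: "\<And>i y z. i \<in> {1..N} \<Longrightarrow> norm (Fi i y - Fi i z) \<le> L i * norm (y - z) powr a i"
    and s: "\<And>i. i \<in> {1..N} \<Longrightarrow> (real N)\<^sup>2 * (L i)\<^sup>2 * a i * s powr (2 * a i) \<le> 1"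
    and "0 < s" "1 \<le> n" "0 \<le> d"
    and dist: "norm (y - z) = s * n powr (- (3 * (1 - \<alpha>) / 2)) * d"
  shows "(norm ((\<Sum>i=1..N. Fi i y) - (\<Sum>i=1..N. Fi i z)))\<^sup>2
    \<le> d\<^sup>2 + (\<Sum>i=1..N. (1 - a i) / (real N * a i)) * n powr (- (3 * \<alpha>))"
proof -
  define t0 where "t0 = n powr (- (3 * \<alpha>))"
  define r where "r = norm (y - z)"
  have r: "r \<ge> 0" by (simp add: r_def)
  have young: "real N * (L i * r powr a i)\<^sup>2 \<le> d\<^sup>2 / real N + (1 - a i) / (real N * a i) * t0"
    if i: "i \<in> {1..N}" for i
  proof -
    \<comment> \<open>\<open>c\<close> is the constant for which \<open>N\<^sup>2\<close> times the squared Hoelder bound equals \<open>c (d\<^sup>2) powr a\<^sub>i\<close>.\<close>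
    define c where "c = (real N)\<^sup>2 * (L i)\<^sup>2 * (s powr (2 * a i) * n powr (- (3 * (1 - \<alpha>) * a i)))"
    have "c * a i = (real N)\<^sup>2 * (L i)\<^sup>2 * a i * s powr (2 * a i) * n powr (- (3 * (1 - \<alpha>) * a i))"
      by (simp add: c_def)
    also have "\<dots> \<le> 1 * n powr (- (3 * (1 - \<alpha>) * a i))"
      using s[OF i] by (intro mult_right_mono) auto
    also have "\<dots> \<le> 1 * n powr (- (3 * \<alpha>) * (1 - a i))"
      using a[OF i] \<open>1 \<le> n\<close> by (auto intro!: powr_mono simp: algebra_simps)
    also have "\<dots> = t0 powr (1 - a i)" by (simp add: t0_def powr_powr)
    finally have "c * (d\<^sup>2) powr a i \<le> d\<^sup>2 + (1 - a i) / a i * t0"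
      using a[OF i] \<open>1 \<le> n\<close> by (intro scaled_powr_le_affine) (auto simp: t0_def)
    moreover have "(real N)\<^sup>2 * (L i * r powr a i)\<^sup>2 = c * (d\<^sup>2) powr a i"
    proof -
      have "(r powr a i)\<^sup>2 = r powr (2 * a i)"
        by (simp add: power2_eq_square flip: powr_add)
      also have "\<dots> = s powr (2 * a i) * n powr (- (3 * (1 - \<alpha>) * a i)) * d powr (2 * a i)"
        unfolding r_def dist using \<open>0 < s\<close> \<open>1 \<le> n\<close> \<open>0 \<le> d\<close>
        by (simp add: powr_mult powr_powr)
      also have "d powr (2 * a i) = (d\<^sup>2) powr a i"
        using \<open>0 \<le> d\<close> by (simp add: powr_powr flip: powr_numeral)
      finally show ?thesis by (simp add: c_def power_mult_distrib)
    qed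
    ultimately have "(real N)\<^sup>2 * (L i * r powr a i)\<^sup>2 \<le> d\<^sup>2 + (1 - a i) / a i * t0" by simp
    then have "(real N)\<^sup>2 * (L i * r powr a i)\<^sup>2 / real N \<le> (d\<^sup>2 + (1 - a i) / a i * t0) / real N"
      by (intro divide_right_mono) auto
    then show ?thesis using N by (simp add: power2_eq_square add_divide_distrib mult.commute)
  qed
  have "norm ((\<Sum>i=1..N. Fi i y) - (\<Sum>i=1..N. Fi i z)) \<le> (\<Sum>i=1..N. L i * r powr a i)"
    unfolding sum_subtractf[symmetric] r_def using hoelder by (intro sum_norm_le) auto
  then have "(norm ((\<Sum>i=1..N. Fi i y) - (\<Sum>i=1..N. Fi i z)))\<^sup>2 \<le> (\<Sum>i=1..N. L i * r powr a i)\<^sup>2"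
    by (intro power_mono) auto
  also have "\<dots> \<le> (\<Sum>i=1..N. real N * (L i * r powr a i)\<^sup>2)"
    using sum_squared_le_sum_of_squares[of "\<lambda>i. L i * r powr a i" "{1..N}"]
    by (simp add: mult.commute flip: sum_distrib_left)
  also have "\<dots> \<le> (\<Sum>i=1..N. d\<^sup>2 / real N + (1 - a i) / (real N * a i) * t0)"
    using young by (intro sum_mono) auto
  also have "\<dots> = d\<^sup>2 + (\<Sum>i=1..N. (1 - a i) / (real N * a i)) * t0"
    using N by (simp add: sum.distrib sum_distrib_right)
  finally show ?thesis by (simp add: t0_def)
qed

section \<open>The convergence rate\<close>

text \<open>
  The bound on the residual with explicit constants, valid from the first iterate on. Its proof sums
  the increments of the potential \<open>V\<close>, which starts at \<open>0\<close> because \<open>\<Sigma>\<^sub>0 = 0\<close>.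
\<close>
lemma gcfeg_residual_bound:
  fixes Fi :: "nat \<Rightarrow> 'a::{real_inner, complete_space} \<Rightarrow> 'a"
    and F :: "'a \<Rightarrow> 'a" and G :: "'a \<Rightarrow> 'a set" and N :: nat
    and L a :: "nat \<Rightarrow> real" and \<alpha> s :: real and x0 z :: 'a and x :: "nat \<Rightarrow> 'a"
  assumes N: "N \<ge> 1"
    and \<alpha>: "1/3 < \<alpha>" "\<alpha> \<le> 1"
    and a: "\<And>i. i \<in> {1..N} \<Longrightarrow> \<alpha> \<le> a i \<and> a i \<le> 1"
    and L: "\<And>i. i \<in> {1..N} \<Longrightarrow> L i > 0"
    and hoelder: "\<And>i y z. i \<in> {1..N} \<Longrightarrow> norm (Fi i y - Fi i z) \<le> L i * norm (y - z) powr a i"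
    and F: "F = (\<lambda>y. \<Sum>i=1..N. Fi i y)"
    and G: "maximally_monotone G"
    and T: "monotone_operator (op_sum F G)"
    and z: "0 \<in> op_sum F G z"
    and s: "0 < s" "\<And>i. i \<in> {1..N} \<Longrightarrow> s \<le> 1 / ((real N)\<^sup>2 * (L i)\<^sup>2 * a i) powr (1 / (2 * a i))"
    and alg: "gcfeg F G \<alpha> s x0 x"
    and K: "K \<ge> 1"
  shows "\<exists>u \<in> op_sum F G (x K). (norm u)\<^sup>2 \<le>
    4 / s\<^sup>2 * ((norm (z - x0))\<^sup>2 + 2 * (s / (3 * \<alpha> - 1))\<^sup>2 *
      (\<Sum>i=1..N. (1 - a i) / (real N * a i)) * (1 + ln (real K))) * real K powr (- (3 * \<alpha> - 1))"
proof -
  define p where "p = 3 * (1 - \<alpha>) / 2"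
  have p: "0 \<le> p" "p < 1" using \<alpha> by (auto simp: p_def)
  have exponent: "2 * (1 - p) = 3 * \<alpha> - 1" by (simp add: p_def field_simps)
  define S where "S = (\<Sum>i=1..N. (1 - a i) / (real N * a i))"
  have apos: "0 < a i" if "i \<in> {1..N}" for i using a[OF that] \<alpha> by simp
  have S: "S \<ge> 0" unfolding S_def using a apos N by (intro sum_nonneg) (auto intro!: divide_nonneg_pos)
  have small: "(real N)\<^sup>2 * (L i)\<^sup>2 * a i * s powr (2 * a i) \<le> 1" if i: "i \<in> {1..N}" for i
    using apos[OF i] L[OF i] N s(1) s(2)[OF i] by (intro stepsize_le_imp_powr_le_1) auto
  from alg obtain st \<Sigma> b :: "nat \<Rightarrow> real" and xt xh gt :: "nat \<Rightarrow> 'a"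
    where \<Sigma>0: "\<Sigma> 0 = 0" and x_0: "x 0 = x0"
      and st: "\<And>k. st (k + 1) = s / real (k + 1) powr (3 * (1 - \<alpha>) / 2)"
      and b: "\<And>k. b (k + 1) = st (k + 1) / (2 * \<Sigma> k + st (k + 1))"
      and xt: "\<And>k. xt (k + 1) = b (k + 1) *\<^sub>R x0 + (1 - b (k + 1)) *\<^sub>R x k"
      and xh: "\<And>k. xh k = xt (k + 1) - ((1 - b (k + 1)) * st (k + 1)) *\<^sub>R (F (x k) + gt k)"
      and xs: "\<And>k. x (k + 1) = resolvent (st (k + 1)) G (xt (k + 1) - st (k + 1) *\<^sub>R F (xh k))"
      and gt: "\<And>k. gt (k + 1) = (1 / st (k + 1)) *\<^sub>R (xt (k + 1) - x (k + 1) - st (k + 1) *\<^sub>R F (xh k))"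
      and \<Sigma>: "\<And>k. \<Sigma> (k + 1) = \<Sigma> k + st (k + 1) / 2"
    unfolding gcfeg_def by blast
  have st_eq: "st (Suc k) = s * real (Suc k) powr (- p)" for k
    using st[of k] by (simp add: p_def powr_minus_divide)
  have st_pos: "st (Suc k) > 0" for k using s(1) by (simp add: st_eq)

  have \<Sigma>_sum: "\<Sigma> k = s / 2 * (\<Sum>j<k. real (Suc j) powr (- p))" for k
  proof (induction k)
    case (Suc k)
    then show ?case using \<Sigma>[of k] st_eq[of k] by (simp add: algebra_simps)
  qed (simp add: \<Sigma>0)
  have \<Sigma>_lower: "s / 2 * real k powr (1 - p) \<le> \<Sigma> k" for k
    unfolding \<Sigma>_sum using sum_powr_bounds(1)[OF p] s(1) by (intro mult_left_mono) auto
  have \<Sigma>_nonneg: "\<Sigma> k \<ge> 0" for k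
    by (rule order_trans[OF _ \<Sigma>_lower]) (use s(1) in simp)
  have \<Sigma>_upper: "\<Sigma> k \<le> s / (3 * \<alpha> - 1) * real k powr (1 - p)" for k
  proof -
    have "(1 - p) * \<Sigma> k \<le> s / 2 * real k powr (1 - p)"
      unfolding \<Sigma>_sum using mult_left_mono[OF sum_powr_bounds(2)[OF p, of k], of "s / 2"] s(1)
      by (simp add: algebra_simps)
    then have "(3 * \<alpha> - 1) * \<Sigma> k \<le> s * real k powr (1 - p)"
      unfolding exponent[symmetric] by (simp add: algebra_simps)
    then show ?thesis using \<alpha> by (simp add: field_simps)
  qed
  \<comment> \<open>The exponent \<open>3 \<alpha> - 1\<close> of the final rate is the growth of \<open>\<Sigma>\<^sub>k\<^sup>2\<close>.\<close>
  have powr_sq: "(real k powr (1 - p))\<^sup>2 = real k powr (3 * \<alpha> - 1)" for k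
    by (simp add: power2_eq_square flip: powr_add exponent)

  define u where "u = (\<lambda>k. F (x k) + gt k)"
  define v where "v = (\<lambda>k. F (xh k) + gt (Suc k))"
  have gt_mem: "gt (Suc k) \<in> G (x (Suc k))" for k
  proof -
    let ?y = "xt (Suc k) - st (Suc k) *\<^sub>R F (xh k)"
    have x_eq: "x (Suc k) = resolvent (st (Suc k)) G ?y" using xs[of k] by simp
    have "gt (Suc k) = (1 / st (Suc k)) *\<^sub>R (?y - x (Suc k))"
      unfolding Suc_eq_plus1 gt by (simp add: algebra_simps)
    also have "\<dots> \<in> G (x (Suc k))"
      using resolvent_residual_mem[OF G st_pos[of k], of ?y] by (simp only: x_eq)
    finally show ?thesis .
  qed
  have u_mem: "u k \<in> op_sum F G (x k)" if "k \<ge> 1" for k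
    using gt_mem[of "k - 1"] that by (auto simp: u_def op_sum_def)
  have x_step: "x (Suc k) = xt (Suc k) - st (Suc k) *\<^sub>R v k" for k
  proof -
    have "st (Suc k) *\<^sub>R gt (Suc k) = xt (Suc k) - x (Suc k) - st (Suc k) *\<^sub>R F (xh k)"
      using gt[of k] st_pos[of k] by simp
    then show ?thesis by (simp add: v_def algebra_simps)
  qed
  have half_step: "xh k - x (Suc k) = st (Suc k) *\<^sub>R (v k - (1 - b (Suc k)) *\<^sub>R u k)" for k
    using xh[of k] by (simp add: x_step u_def algebra_simps)

  define V where "V = (\<lambda>k. (\<Sigma> k)\<^sup>2 * (norm (u k))\<^sup>2 + \<Sigma> k * inner (u k) (x k - x0))"
  have V_step: "V (Suc k) \<le> V k + (s / (3 * \<alpha> - 1))\<^sup>2 * S * (1 / real (Suc k))" for k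
  proof -
    define d where "d = norm (v k - (1 - b (Suc k)) *\<^sub>R u k)"
    define n where "n = real (Suc k)"
    have "V (Suc k) \<le> V k + (\<Sigma> (Suc k))\<^sup>2 * ((norm (u (Suc k) - v k))\<^sup>2 - d\<^sup>2)"
      unfolding V_def d_def
    proof (rule anchored_lyapunov_step)
      show "\<Sigma> (Suc k) = \<Sigma> k + st (Suc k) / 2" using \<Sigma>[of k] by simp
      show "b (Suc k) = st (Suc k) / (2 * \<Sigma> k + st (Suc k))" using b[of k] by simp
      show "x (Suc k) = b (Suc k) *\<^sub>R x0 + (1 - b (Suc k)) *\<^sub>R x k - st (Suc k) *\<^sub>R v k"
        using xt[of k] by (simp add: x_step)
      assume "\<Sigma> k > 0"
      then have "k \<ge> 1" using \<Sigma>0 by (cases k) auto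
      then show "inner (u (Suc k) - u k) (x (Suc k) - x k) \<ge> 0"
        using T u_mem unfolding monotone_operator_def by simp
    qed (use \<Sigma>_nonneg st_pos in auto)
    moreover have "(norm (u (Suc k) - v k))\<^sup>2 - d\<^sup>2 \<le> S * n powr (- (3 * \<alpha>))"
    proof -
      have "norm (x (Suc k) - xh k) = s * n powr (- (3 * (1 - \<alpha>) / 2)) * d"
        using st_pos[of k] st_eq[of k]
        by (simp add: norm_minus_commute half_step d_def n_def p_def)
      then have "(norm (F (x (Suc k)) - F (xh k)))\<^sup>2 \<le> d\<^sup>2 + S * n powr (- (3 * \<alpha>))"
        unfolding F S_def using a apos
        by (intro hoelder_sum_increment_le[where L = L and s = s, OF N _ L hoelder small s(1)])
          (auto simp: d_def n_def)
      then show ?thesis by (simp add: u_def v_def)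
    qed
    then have "(\<Sigma> (Suc k))\<^sup>2 * ((norm (u (Suc k) - v k))\<^sup>2 - d\<^sup>2)
        \<le> (\<Sigma> (Suc k))\<^sup>2 * (S * n powr (- (3 * \<alpha>)))"
      by (intro mult_left_mono) auto
    moreover have "(\<Sigma> (Suc k))\<^sup>2 * (S * n powr (- (3 * \<alpha>)))
        \<le> (s / (3 * \<alpha> - 1) * n powr (1 - p))\<^sup>2 * (S * n powr (- (3 * \<alpha>)))"
      unfolding n_def using S by (intro mult_right_mono power_mono \<Sigma>_upper \<Sigma>_nonneg) auto
    moreover have "\<dots> = (s / (3 * \<alpha> - 1))\<^sup>2 * S * (1 / n)"
    \<comment> \<open>The growth \<open>3 \<alpha> - 1\<close> of \<open>\<Sigma>\<^sup>2\<close> against the decay \<open>3 \<alpha>\<close> of the Hoelder error leaves the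
        harmonic series, hence the logarithm.\<close>
    proof -
      have "(n powr (1 - p))\<^sup>2 * n powr (- (3 * \<alpha>)) = n powr (- 1)"
        unfolding n_def powr_sq by (simp flip: powr_add)
      also have "\<dots> = 1 / n" by (simp add: n_def powr_minus_divide)
      finally have "(n powr (1 - p))\<^sup>2 * n powr (- (3 * \<alpha>)) = 1 / n" .
      moreover have "(c * q)\<^sup>2 * (S * r) = c\<^sup>2 * S * (q\<^sup>2 * r)" for c q r :: real
        by (simp add: power_mult_distrib)
      ultimately show ?thesis by metis
    qed
    ultimately show ?thesis by (simp add: n_def)
  qed
  have "V k \<le> (s / (3 * \<alpha> - 1))\<^sup>2 * S * (\<Sum>j<k. 1 / real (Suc j))" for k
  proof (induction k)
    case (Suc k)
    have "V (Suc k) \<le> (s / (3 * \<alpha> - 1))\<^sup>2 * S * (\<Sum>j<k. 1 / real (Suc j))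
        + (s / (3 * \<alpha> - 1))\<^sup>2 * S * (1 / real (Suc k))"
      using V_step[of k] Suc.IH by linarith
    then show ?case by (simp add: distrib_left)
  qed (simp add: V_def \<Sigma>0)
  also have "(s / (3 * \<alpha> - 1))\<^sup>2 * S * (\<Sum>j<K. 1 / real (Suc j))
      \<le> (s / (3 * \<alpha> - 1))\<^sup>2 * S * (1 + ln (real K))"
    using sum_inverse_le_ln[OF K] S by (intro mult_left_mono) auto
  finally have V_K: "V K \<le> (s / (3 * \<alpha> - 1))\<^sup>2 * S * (1 + ln (real K))" .

  define R where "R = norm (z - x0)"
  define y where "y = \<Sigma> K * norm (u K)"
  \<comment> \<open>The residual at the zero \<open>z\<close> is \<open>0\<close>, so monotonicity lets \<open>x K\<close> be replaced by \<open>z\<close> in the inner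
      product of the potential, which then costs at most \<open>y R\<close>.\<close>
  have "0 \<le> inner (u K - 0) (x K - z)"
    using T u_mem[OF K] z unfolding monotone_operator_def by blast
  moreover have "- (norm (u K) * R) \<le> inner (u K) (z - x0)"
    using Cauchy_Schwarz_ineq2[of "u K" "z - x0"] unfolding R_def by linarith
  moreover have "inner (u K) (x K - x0) = inner (u K) (x K - z) + inner (u K) (z - x0)"
    by (simp flip: inner_add_right)
  ultimately have "- (norm (u K) * R) \<le> inner (u K) (x K - x0)" by simp
  from mult_left_mono[OF this \<Sigma>_nonneg[of K]]
  have "y\<^sup>2 - y * R \<le> V K"
    by (simp add: V_def y_def power_mult_distrib algebra_simps)
  moreover have "0 \<le> (y - R)\<^sup>2" by simp
  ultimately have y_sq: "y\<^sup>2 \<le> R\<^sup>2 + 2 * V K"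
    by (simp add: power2_eq_square algebra_simps)
  define B where "B = R\<^sup>2 + 2 * (s / (3 * \<alpha> - 1))\<^sup>2 * S * (1 + ln (real K))"
  have "(s / 2 * real K powr (1 - p))\<^sup>2 * (norm (u K))\<^sup>2 \<le> (\<Sigma> K)\<^sup>2 * (norm (u K))\<^sup>2"
    using \<Sigma>_lower s(1) by (intro mult_right_mono power_mono) auto
  also have "\<dots> = y\<^sup>2" by (simp add: y_def power_mult_distrib)
  also have "\<dots> \<le> B" using y_sq V_K by (simp add: B_def)
  finally have "s\<^sup>2 / 4 * real K powr (3 * \<alpha> - 1) * (norm (u K))\<^sup>2 \<le> B"
    unfolding power_mult_distrib powr_sq by (simp add: power_divide)
  then have "(norm (u K))\<^sup>2 \<le> 4 / s\<^sup>2 * B * real K powr (- (3 * \<alpha> - 1))"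
    using s(1) K by (subst powr_minus) (simp add: field_simps)
  then show ?thesis using u_mem[OF K] unfolding B_def R_def S_def by blast
qed

theorem theorem2:
  fixes Fi :: "nat \<Rightarrow> 'a::{real_inner, complete_space} \<Rightarrow> 'a"
    and F :: "'a \<Rightarrow> 'a"
    and G T :: "'a \<Rightarrow> 'a set"
    and N :: nat
    and L a :: "nat \<Rightarrow> real"
    and \<alpha> s :: real
    and x0 :: 'a
    and x :: "nat \<Rightarrow> 'a"
  assumes "N \<ge> 1"
    and "\<And>i. i \<in> {1..N} \<Longrightarrow> 1/3 < a i \<and> a i \<le> 1"
    and "\<And>i. i \<in> {1..N} \<Longrightarrow> L i > 0"
    and "\<And>i y z. i \<in> {1..N} \<Longrightarrow> norm (Fi i y - Fi i z) \<le> L i * norm (y - z) powr a i"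
    and "F = (\<lambda>y. \<Sum>i=1..N. Fi i y)"
    and "maximally_monotone G"
    and "T = op_sum F G"
    and "monotone_operator T"
    and "op_zeros T \<noteq> {}"
    and "\<alpha> = Min (a ` {1..N})"
    and "0 < s"
    and "s \<le> Min ((\<lambda>i. 1 / ((real N)\<^sup>2 * (L i)\<^sup>2 * a i) powr (1 / (2 * a i))) ` {1..N})"
    and "gcfeg F G \<alpha> s x0 x"
  shows "(\<forall>\<^sub>F K in sequentially. T (x K) \<noteq> {}) \<and>
    (\<lambda>K. (infdist 0 (T (x K)))\<^sup>2) \<in>
      O(\<lambda>K. (1 / ((3 * \<alpha> - 1)\<^sup>2 * s\<^sup>2) +
               (\<Sum>i=1..N. (1 - a i) * ln (real K) / (real N * a i))) *
             real K powr (- (3 * \<alpha> - 1)))"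
proof -
  have N: "N \<ge> 1" by fact
  have a_ne: "finite (a ` {1..N})" "a ` {1..N} \<noteq> {}" using N by auto
  have \<alpha>_le: "\<alpha> \<le> a i" if "i \<in> {1..N}" for i
    unfolding assms(10) using that by (intro Min_le) auto
  obtain i where "i \<in> {1..N}" "\<alpha> = a i"
    using Min_in[OF a_ne] assms(10) by auto
  then have \<alpha>: "1/3 < \<alpha>" "\<alpha> \<le> 1" using assms(2) by auto
  have s_le: "s \<le> 1 / ((real N)\<^sup>2 * (L i)\<^sup>2 * a i) powr (1 / (2 * a i))" if "i \<in> {1..N}" for i
    using assms(12) that by (auto intro: order_trans[OF _ Min_le])
  obtain z where z: "0 \<in> T z" using assms(9) by (auto simp: op_zeros_def)
  define S where "S = (\<Sum>i=1..N. (1 - a i) / (real N * a i))"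
  define A where "A = 1 / ((3 * \<alpha> - 1)\<^sup>2 * s\<^sup>2)"
  define R where "R = norm (z - x0)"
  have S: "S \<ge> 0" unfolding S_def
    using assms(2) N by (intro sum_nonneg divide_nonneg_nonneg) force+
  have bound: "\<exists>u\<in>T (x K). (norm u)\<^sup>2 \<le> 4 / s\<^sup>2 * (R\<^sup>2 + 2 * (s / (3 * \<alpha> - 1))\<^sup>2 * S * (1 + ln (real K)))
      * real K powr (- (3 * \<alpha> - 1))" if "K \<ge> 1" for K
    unfolding assms(7) R_def S_def
    using assms(2) assms(8) z \<alpha>_le s_le that unfolding assms(7)
    by (intro gcfeg_residual_bound[OF N \<alpha> _ assms(3,4,5,6) _ _ assms(11) _ assms(13)]) auto
  \<comment> \<open>The three summands of \<open>C\<close> absorb the distance term, the constant and the logarithmic part of the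
      harmonic sum; the first two are compared with \<open>A\<close>, the last with \<open>S * ln K\<close>.\<close>
  define C where "C = 4 * (3 * \<alpha> - 1)\<^sup>2 * R\<^sup>2 + 8 * s\<^sup>2 * S + 8 / (3 * \<alpha> - 1)\<^sup>2"
  have A: "A > 0" using \<alpha> assms(11) by (simp add: A_def)
  have est: "4 / s\<^sup>2 * (R\<^sup>2 + 2 * (s / (3 * \<alpha> - 1))\<^sup>2 * S * (1 + ln (real K))) \<le> C * (A + S * ln (real K))"
    if "K \<ge> 1" for K
  proof -
    have ln: "ln (real K) \<ge> 0" using that by simp
    have "3 * \<alpha> - 1 \<noteq> 0" "s \<noteq> 0" using \<alpha> assms(11) by auto
    then have "4 / s\<^sup>2 * (R\<^sup>2 + 2 * (s / (3 * \<alpha> - 1))\<^sup>2 * S * (1 + ln (real K)))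
        = (4 * (3 * \<alpha> - 1)\<^sup>2 * R\<^sup>2 + 8 * s\<^sup>2 * S) * A + 8 / (3 * \<alpha> - 1)\<^sup>2 * (S * ln (real K))"
      by (simp add: A_def power_divide distrib_left add_divide_distrib)
    also have "\<dots> \<le> C * A + C * (S * ln (real K))"
    proof (intro add_mono mult_right_mono)
      show "4 * (3 * \<alpha> - 1)\<^sup>2 * R\<^sup>2 + 8 * s\<^sup>2 * S \<le> C" by (simp add: C_def)
      show "8 / (3 * \<alpha> - 1)\<^sup>2 \<le> C" using S by (simp add: C_def)
    qed (use A S ln in auto)
    finally show ?thesis by (simp add: distrib_left)
  qed
  show ?thesis
  proof
    show "\<forall>\<^sub>F K in sequentially. T (x K) \<noteq> {}"
      using eventually_ge_at_top[of 1] by eventually_elim (use bound in blast)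
    have "\<forall>\<^sub>F K in sequentially. norm ((infdist 0 (T (x K)))\<^sup>2)
        \<le> C * norm ((A + S * ln (real K)) * real K powr (- (3 * \<alpha> - 1)))"
      using eventually_ge_at_top[of 1]
    proof eventually_elim
      case (elim K)
      from bound[OF elim] obtain u where u: "u \<in> T (x K)"
        and u_le: "(norm u)\<^sup>2 \<le> 4 / s\<^sup>2 * (R\<^sup>2 + 2 * (s / (3 * \<alpha> - 1))\<^sup>2 * S * (1 + ln (real K)))
          * real K powr (- (3 * \<alpha> - 1))" by blast
      have "infdist 0 (T (x K)) \<le> norm u" using infdist_le[OF u, of 0] by simp
      then have "(infdist 0 (T (x K)))\<^sup>2 \<le> (norm u)\<^sup>2"
        by (intro power_mono infdist_nonneg)
      also note u_le
      also have "4 / s\<^sup>2 * (R\<^sup>2 + 2 * (s / (3 * \<alpha> - 1))\<^sup>2 * S * (1 + ln (real K)))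
          * real K powr (- (3 * \<alpha> - 1)) \<le> C * (A + S * ln (real K)) * real K powr (- (3 * \<alpha> - 1))"
        by (intro mult_right_mono est elim) simp
      moreover have "0 \<le> A + S * ln (real K)" using A S elim by simp
      ultimately show ?case by (simp add: mult.assoc)
    qed
    then have "(\<lambda>K. (infdist 0 (T (x K)))\<^sup>2)
        \<in> O(\<lambda>K. (A + S * ln (real K)) * real K powr (- (3 * \<alpha> - 1)))"
      by (rule bigoI)
    then show "(\<lambda>K. (infdist 0 (T (x K)))\<^sup>2) \<in>
      O(\<lambda>K. (1 / ((3 * \<alpha> - 1)\<^sup>2 * s\<^sup>2) +
               (\<Sum>i=1..N. (1 - a i) * ln (real K) / (real N * a i))) *
             real K powr (- (3 * \<alpha> - 1)))"
      by (simp add: A_def S_def sum_distrib_right)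
  qed
qed

end
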